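(* For any finite connected graph $G$, there exists a spanning tree $T$ of $G$ such that $\gamma_{gr}(G)\le\gamma_{gr}(T)$.
   Context: For a graph $G$, a sequence of vertices $S=(v_1,\dots,v_k)$ is a legal sequence if for every $i\in[k]$, $N[v_i]\setminus\bigcup_{j=1}^{i-1}N[v_j]\neq\emptyset$ ($N[v]$ the closed neighborhood). The Grundy domination number $\gamma_{gr}(G)$ is the maximum length of a legal sequence of $G$. *)

theory Defs
  imports "Graph_Theory.Digraph_Component"
begin

text \<open>
  Finite simple graphs are modelled by \<^locale>\<open>pair_graph\<close>: finite, loop-free, symmetric
  digraphs whose arcs are pairs of vertices. The library's \<^const>\<open>forest\<close> and
  \<^const>\<open>spanning_tree\<close> cannot be used for such graphs, because they count the walk
  \<open>u, v, u\<close> along an edge as a cycle. In a simple graph the undirected cycles are exactly the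
  cycles of the symmetric digraph that have length at least 3.
\<close>

definition undirected_acyclic :: "'a pair_pre_digraph \<Rightarrow> bool" where
  "undirected_acyclic G \<longleftrightarrow> \<not> (\<exists>p. pre_digraph.cycle (with_proj G) p \<and> 3 \<le> length p)"

definition undirected_tree :: "'a pair_pre_digraph \<Rightarrow> bool" where
  "undirected_tree T \<longleftrightarrow>
     pair_graph T \<and> Digraph_Component.connected (with_proj T) \<and> undirected_acyclic T"

definition undirected_spanning_tree :: "'a pair_pre_digraph \<Rightarrow> 'a pair_pre_digraph \<Rightarrow> bool" where
  "undirected_spanning_tree T G \<longleftrightarrow>
     undirected_tree T \<and> spanning (with_proj T) (with_proj G)"

definition closed_neighborhood :: "'a pair_pre_digraph \<Rightarrow> 'a \<Rightarrow> 'a set" where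
  "closed_neighborhood G v = insert v {u. (v, u) \<in> parcs G}"

definition legal_sequence :: "'a pair_pre_digraph \<Rightarrow> 'a list \<Rightarrow> bool" where
  "legal_sequence G vs \<longleftrightarrow> set vs \<subseteq> pverts G \<and>
     (\<forall>i < length vs.
        closed_neighborhood G (vs ! i) - (\<Union>j<i. closed_neighborhood G (vs ! j)) \<noteq> {})"

definition grundy_domination_number :: "'a pair_pre_digraph \<Rightarrow> nat" where
  "grundy_domination_number G = Max {length vs |vs. legal_sequence G vs}"

text \<open>For finite graphs the maximum is taken over a finite nonempty set.\<close>

lemma legal_sequence_distinct:
  assumes "legal_sequence G vs"
  shows "distinct vs"
proof -
  have "vs ! i \<noteq> vs ! j" if "j < i" "i < length vs" for i j
    using assms that unfolding legal_sequence_def by fastforce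
  then show ?thesis
    unfolding distinct_conv_nth by (metis linorder_neqE_nat)
qed

lemma finite_legal_sequence_lengths:
  assumes "finite (pverts G)"
  shows "finite {length vs |vs. legal_sequence G vs}"
proof (rule finite_subset)
  show "{length vs |vs. legal_sequence G vs} \<subseteq> {..card (pverts G)}"
  proof clarsimp
    fix vs assume vs: "legal_sequence G vs"
    then have "length vs = card (set vs)"
      by (simp add: distinct_card legal_sequence_distinct)
    also have "\<dots> \<le> card (pverts G)"
      using vs assms by (simp add: card_mono legal_sequence_def)
    finally show "length vs \<le> card (pverts G)" .
  qed
qed simp

lemma legal_sequence_lengths_nonempty: "{length vs |vs. legal_sequence G vs} \<noteq> {}"
proof -
  have "legal_sequence G []"
    by (simp add: legal_sequence_def)
  then show ?thesis by blast
qed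

end

theory Submission
  imports Defs
begin

text \<open>
  Pick for every vertex \<open>v\<^sub>i\<close> of a longest legal sequence a vertex \<open>w\<^sub>i\<close> that is first
  dominated by \<open>v\<^sub>i\<close>. When the edges \<open>v\<^sub>i w\<^sub>i\<close> (for \<open>w\<^sub>i \<noteq> v\<^sub>i\<close>) are added in the order of the
  sequence, \<open>w\<^sub>i\<close> is always an isolated vertex: it lies in none of the earlier closed
  neighbourhoods, hence differs from every earlier \<open>v\<^sub>j\<close> and \<open>w\<^sub>j\<close>. So these edges form a forest,
  which extends to a spanning tree. In the tree, closed neighbourhoods only shrink and \<open>w\<^sub>i\<close> is
  still dominated by \<open>v\<^sub>i\<close>, so the sequence remains legal.
\<close>

text \<open>Acyclicity in the form "every edge is a bridge", so that adding an edge is a matter of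
  reachability rather than of cycles. Reflexivity of the closure excludes loops.\<close>

definition forest_arcs :: "('a \<times> 'a) set \<Rightarrow> bool" where
  "forest_arcs A \<longleftrightarrow>
     sym A \<and> (\<forall>x y. (x, y) \<in> A \<longrightarrow> (x, y) \<notin> (A - {(x, y), (y, x)})\<^sup>*)"

lemma rtrancl_symD: "sym A \<Longrightarrow> (x, y) \<in> A\<^sup>* \<Longrightarrow> (y, x) \<in> A\<^sup>*"
  by (meson sym_rtrancl symD)

text \<open>Cut a walk at its first and last use of the new edge. If these go in opposite
  directions, the two outer pieces already join up inside \<open>B\<close>.\<close>

lemma rtrancl_insert_edge_cases:
  assumes "(a, b) \<in> (B \<union> {(x, y), (y, x)})\<^sup>*"
  shows "(a, b) \<in> B\<^sup>* \<or> (a, x) \<in> B\<^sup>* \<and> (y, b) \<in> B\<^sup>* \<or> (a, y) \<in> B\<^sup>* \<and> (x, b) \<in> B\<^sup>*"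
  using assms
proof (induction rule: rtrancl_induct)
  case base
  then show ?case by simp
next
  case (step b c)
  from step.hyps(2) consider "(b, c) \<in> B" | "b = x" "c = y" | "b = y" "c = x" by auto
  then show ?case
    using step.IH by cases (auto intro: rtrancl_into_rtrancl)
qed

text \<open>A detour around an old edge must use the new one; rerouted through the old edge, it
  would connect \<open>x\<close> to \<open>y\<close> inside \<open>A\<close>.\<close>

lemma forest_arcs_insert_edge:
  assumes A: "forest_arcs A" and xy: "(x, y) \<notin> A\<^sup>*"
  shows "forest_arcs (A \<union> {(x, y), (y, x)})" (is "forest_arcs ?A'")
proof -
  have symA: "sym A" using A by (simp add: forest_arcs_def)
  have yx: "(y, x) \<notin> A\<^sup>*" using xy rtrancl_symD[OF symA] by blast
  have "(a, b) \<notin> (?A' - {(a, b), (b, a)})\<^sup>*" if ab: "(a, b) \<in> ?A'" for a b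
  proof
    assume reach: "(a, b) \<in> (?A' - {(a, b), (b, a)})\<^sup>*"
    show False
    proof (cases "(a, b) \<in> A")
      case False
      then have "(a, b) = (x, y) \<or> (a, b) = (y, x)" using ab by auto
      \<comment> \<open>The deleted edge is the new one, so the detour lies entirely in
        \<open>A\<close>.\<close>
      then have "(?A' - {(a, b), (b, a)}) \<subseteq> A" by auto
      then have "(a, b) \<in> A\<^sup>*" using reach rtrancl_mono by blast
      then show False using xy yx \<open>(a, b) = (x, y) \<or> (a, b) = (y, x)\<close> by auto
    next
      case True
      let ?B = "A - {(a, b), (b, a)}"
      have sub: "?B\<^sup>* \<subseteq> A\<^sup>*" by (simp add: rtrancl_mono)
      have "?A' - {(a, b), (b, a)} \<subseteq> ?B \<union> {(x, y), (y, x)}" by auto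
      then have "(a, b) \<in> (?B \<union> {(x, y), (y, x)})\<^sup>*" using reach rtrancl_mono by blast
      moreover have "(a, b) \<notin> ?B\<^sup>*" using A True by (simp add: forest_arcs_def)
      ultimately have "(a, x) \<in> A\<^sup>* \<and> (y, b) \<in> A\<^sup>* \<or> (a, y) \<in> A\<^sup>* \<and> (x, b) \<in> A\<^sup>*"
        using rtrancl_insert_edge_cases[of a b ?B x y] sub by blast
      moreover have "(a, b) \<in> A\<^sup>*" using True by blast
      ultimately have "(x, y) \<in> A\<^sup>*"
        by (meson rtrancl_symD[OF symA] rtrancl_trans)
      then show False using xy by blast
    qed
  qed
  moreover have "sym ?A'" using symA by (auto simp: sym_def)
  ultimately show ?thesis by (simp add: forest_arcs_def)
qed

lemma forest_arcs_insert_leaf: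
  assumes "forest_arcs A" "x \<noteq> y" "y \<notin> Field A"
  shows "forest_arcs (A \<union> {(x, y), (y, x)})"
proof (rule forest_arcs_insert_edge[OF assms(1)])
  show "(x, y) \<notin> A\<^sup>*"
    using assms(2,3) by (metis FieldI2 rtranclE)
qed

lemma maximal_forest_arcs_rtrancl:
  assumes A: "forest_arcs A" and "sym E" "A \<subseteq> E"
    and max: "\<And>B. \<lbrakk>forest_arcs B; A \<subseteq> B; B \<subseteq> E\<rbrakk> \<Longrightarrow> B = A"
  shows "E \<subseteq> A\<^sup>*"
proof (rule ccontr)
  assume "\<not> E \<subseteq> A\<^sup>*"
  then obtain x y where xy: "(x, y) \<in> E" "(x, y) \<notin> A\<^sup>*" by auto
  then have "A \<union> {(x, y), (y, x)} \<subseteq> E" using assms(2,3) by (auto simp: sym_def)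
  then have "A \<union> {(x, y), (y, x)} = A"
    using max forest_arcs_insert_edge[OF A xy(2)] by blast
  then show False using xy(2) by blast
qed

text \<open>Only finitely many forests lie between \<open>F\<close> and \<open>E\<close>. An
  inclusion-maximal one spans, since an edge of \<open>E\<close> joining two of its components could
  still be added.\<close>

lemma forest_arcs_extend_maximal:
  assumes "finite E" "sym E" "forest_arcs F" "F \<subseteq> E"
  obtains A where "forest_arcs A" "F \<subseteq> A" "A \<subseteq> E" "E \<subseteq> A\<^sup>*"
proof -
  let ?S = "{A. forest_arcs A \<and> F \<subseteq> A \<and> A \<subseteq> E}"
  have "finite ?S" by (rule finite_subset[of _ "Pow E"]) (use assms(1) in auto)
  moreover have "F \<in> ?S" using assms by auto
  ultimately have "\<exists>A\<in>?S. F \<subseteq> A \<and> (\<forall>B\<in>?S. A \<subseteq> B \<longrightarrow> A = B)"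
    by (rule finite_has_maximal2)
  then obtain A where A: "A \<in> ?S" and max: "\<forall>B\<in>?S. A \<subseteq> B \<longrightarrow> A = B"
    by (elim bexE conjE)
  have "E \<subseteq> A\<^sup>*"
    using A max by (intro maximal_forest_arcs_rtrancl[OF _ assms(2)]) auto
  then show ?thesis using A that by auto
qed

lemma cas_with_proj_rtrancl:
  "pre_digraph.cas (with_proj G) u p v \<Longrightarrow> set p \<subseteq> A \<Longrightarrow> (u, v) \<in> A\<^sup>*"
proof (induction p arbitrary: u)
  case Nil
  then show ?case by (simp add: pre_digraph.cas.simps)
next
  case (Cons e p)
  then have "(u, snd e) \<in> A" and "(snd e, v) \<in> A\<^sup>*"
    by (auto simp: pre_digraph.cas.simps)
  then show ?case by (rule converse_rtrancl_into_rtrancl)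
qed

text \<open>After its first arc, a cycle returns to its start by a detour avoiding that arc in both
  orientations, so the arc would not be a bridge.\<close>

lemma forest_arcs_undirected_acyclic:
  assumes "pair_wf_digraph T" "forest_arcs (parcs T)"
  shows "undirected_acyclic T"
  unfolding undirected_acyclic_def
proof
  interpret pair_wf_digraph T by fact
  assume "\<exists>p. pre_digraph.cycle (with_proj T) p \<and> 3 \<le> length p"
  then obtain p u where walk: "awalk u p u" and dist: "distinct (tl (pawalk_verts u p))"
    and len: "3 \<le> length p"
    by (auto simp: cycle_def)
  from len obtain e f g r where p: "p = e # f # g # r"
    by (metis (no_types) Suc_le_length_iff numeral_3_eq_3)
  let ?q = "f # g # r"
  let ?y = "snd e"
  have cas: "pcas ?y ?q u" and arcs: "set ?q \<subseteq> parcs T" and e: "e = (u, ?y)" "e \<in> parcs T"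
    using walk p by (auto simp: awalk_def)
  have f: "fst f = ?y" and g: "fst g = snd f" using cas by auto
  have "distinct (map fst ?q @ [snd (last ?q)])" using dist p by (simp add: awalk_verts_conv)
  moreover have "snd (last ?q) = u"
    using awlast_if_cas[OF cas] by (simp add: awalk_verts_conv)
  ultimately have "distinct (map fst ?q)" and u: "u \<notin> fst ` set ?q" by auto
  \<comment> \<open>Tails in \<open>?q\<close> are distinct, so the reversed arc could only be
    \<open>f\<close>. Then \<open>g\<close> would start at \<open>u\<close>, which is no tail in
    \<open>?q\<close>. The length bound enters here, by providing \<open>g\<close>.\<close>
  then have "(?y, u) \<notin> set ?q" using f g by force
  moreover have "(u, ?y) \<notin> set ?q" using u by force
  ultimately have "set ?q \<subseteq> parcs T - {(?y, u), (u, ?y)}" using arcs by auto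
  then have "(?y, u) \<in> (parcs T - {(?y, u), (u, ?y)})\<^sup>*"
    using cas cas_with_proj_rtrancl[of T ?y ?q u] by simp
  moreover have "(?y, u) \<in> parcs T" using assms e by (metis forest_arcs_def symD)
  ultimately show False using assms(2) by (simp add: forest_arcs_def)
qed

text \<open>Symmetric arcs make the symmetrisation in the library's connectedness harmless, leaving
  plain reachability.\<close>

lemma connected_pair_graph_iff:
  assumes "pair_graph G"
  shows "Digraph_Component.connected (with_proj G) \<longleftrightarrow>
    pverts G \<noteq> {} \<and> (\<forall>u\<in>pverts G. \<forall>v\<in>pverts G. (u, v) \<in> (parcs G)\<^sup>*)"
proof -
  interpret pair_graph G by fact
  have "u \<rightarrow>\<^sup>*\<^bsub>with_proj G\<^esub> v \<longleftrightarrow> (u, v) \<in> (parcs G)\<^sup>*" if "u \<in> pverts G" for u v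
  proof
    assume "(u, v) \<in> (parcs G)\<^sup>*"
    then show "u \<rightarrow>\<^sup>*\<^bsub>with_proj G\<^esub> v"
    proof (induction rule: rtrancl_induct)
      case base
      then show ?case using that by simp
    next
      case (step y z)
      then show ?case using reachable_adj_trans by simp
    qed
  next
    assume "u \<rightarrow>\<^sup>*\<^bsub>with_proj G\<^esub> v"
    then show "(u, v) \<in> (parcs G)\<^sup>*" using reachable_rtranclI by force
  qed
  then show ?thesis
    unfolding Digraph_Component.connected_def strongly_connected_def
    using reachable_mk_symmetric_eq[OF pair_sym_arcs] by auto
qed

lemma forest_arcs_spanning_tree:
  assumes G: "pair_graph G" and "Digraph_Component.connected (with_proj G)"
    and A: "forest_arcs A" "A \<subseteq> parcs G" "parcs G \<subseteq> A\<^sup>*"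
  shows "undirected_spanning_tree \<lparr>pverts = pverts G, parcs = A\<rparr> G"
    (is "undirected_spanning_tree ?T G")
proof -
  interpret G: pair_graph G by fact
  have T: "pair_graph ?T"
    using A(1,2) G.arc_fst_in_verts G.arc_snd_in_verts G.pair_no_loops G.pair_finite_verts
      finite_subset[OF A(2) G.pair_finite_arcs]
    by unfold_locales (fastforce simp: symmetric_def forest_arcs_def)+
  then interpret T: pair_graph ?T .
  have "(parcs G)\<^sup>* \<subseteq> A\<^sup>*" using rtrancl_mono[OF A(3)] by simp
  then have "Digraph_Component.connected (with_proj ?T)"
    using assms(2) by (auto simp: connected_pair_graph_iff[OF G] connected_pair_graph_iff[OF T])
  moreover have "spanning (with_proj ?T) (with_proj G)"
    using A(2) G.wf_digraph_axioms T.wf_digraph_axioms by (auto simp: spanning_def subgraph_def)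
  moreover have "undirected_acyclic ?T"
    using A(1) T.pair_wf_digraph by (simp add: forest_arcs_undirected_acyclic)
  ultimately show ?thesis
    using T by (simp add: undirected_spanning_tree_def undirected_tree_def)
qed

text \<open>Indices where a vertex footprints itself are skipped, as they would give loops. The
  bound \<open>n\<close> permits induction along the sequence.\<close>

definition footprint_arcs :: "'a list \<Rightarrow> (nat \<Rightarrow> 'a) \<Rightarrow> nat \<Rightarrow> ('a \<times> 'a) set" where
  "footprint_arcs vs w n = (\<Union>i\<in>{i. i < n \<and> w i \<noteq> vs ! i}. {(vs ! i, w i), (w i, vs ! i)})"

lemma footprint_arcs_Suc:
  "footprint_arcs vs w (Suc n) = footprint_arcs vs w n \<union>
     (if w n = vs ! n then {} else {(vs ! n, w n), (w n, vs ! n)})"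
  unfolding footprint_arcs_def by (auto simp: less_Suc_eq)

lemma forest_footprint_arcs:
  assumes "\<And>i. i < n \<Longrightarrow>
    w i \<in> closed_neighborhood G (vs ! i) - (\<Union>j<i. closed_neighborhood G (vs ! j))"
  shows "forest_arcs (footprint_arcs vs w n)"
  using assms
proof (induction n)
  case 0
  then show ?case by (simp add: footprint_arcs_def forest_arcs_def sym_def)
next
  case (Suc n)
  \<comment> \<open>Both \<open>vs ! i\<close> and \<open>w i\<close> lie in the earlier closed
    neighborhood that \<open>w n\<close> avoids. Only \<open>w n\<close> has to be new:
    \<open>vs ! n\<close> may already be in the forest.\<close>
  have "w n \<noteq> vs ! i \<and> w n \<noteq> w i" if "i < n" for i
    using Suc.prems[of n] Suc.prems[of i] that by (auto simp: closed_neighborhood_def)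
  then have "w n \<notin> Field (footprint_arcs vs w n)"
    by (auto simp: footprint_arcs_def Field_def)
  with Suc show ?case
    using forest_arcs_insert_leaf[of "footprint_arcs vs w n" "vs ! n" "w n"]
    by (auto simp: footprint_arcs_Suc)
qed

theorem theorem5p1:
  fixes G :: "'a pair_pre_digraph"
  assumes "pair_graph G"
    and "Digraph_Component.connected (with_proj G)"
  shows "\<exists>T. undirected_spanning_tree T G \<and>
             grundy_domination_number G \<le> grundy_domination_number T"
proof -
  interpret pair_graph G by fact
  have symG: "sym (parcs G)" using pair_sym_arcs by (simp add: symmetric_def)
  have "grundy_domination_number G \<in> {length vs |vs. legal_sequence G vs}"
    unfolding grundy_domination_number_def
    by (intro Max_in finite_legal_sequence_lengths pair_finite_verts
        legal_sequence_lengths_nonempty)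
  then obtain vs where vs: "legal_sequence G vs"
    and len: "length vs = grundy_domination_number G" by auto
  \<comment> \<open>The length guard stands under the existential so that a total choice function
    \<open>w\<close> can be extracted.\<close>
  from vs have "\<forall>i. \<exists>w. i < length vs \<longrightarrow>
      w \<in> closed_neighborhood G (vs ! i) - (\<Union>j<i. closed_neighborhood G (vs ! j))"
    unfolding legal_sequence_def by blast
  then obtain w where w: "\<And>i. i < length vs \<Longrightarrow>
      w i \<in> closed_neighborhood G (vs ! i) - (\<Union>j<i. closed_neighborhood G (vs ! j))"
    by metis
  let ?F = "footprint_arcs vs w (length vs)"
  have "?F \<subseteq> parcs G"
    using w symG by (fastforce simp: footprint_arcs_def closed_neighborhood_def dest: symD)
  then obtain A where A: "forest_arcs A" "?F \<subseteq> A" "A \<subseteq> parcs G" "parcs G \<subseteq> A\<^sup>*"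
    using forest_arcs_extend_maximal[OF pair_finite_arcs symG] forest_footprint_arcs[OF w]
    by metis
  let ?T = "\<lparr>pverts = pverts G, parcs = A\<rparr>"
  have sub: "closed_neighborhood ?T v \<subseteq> closed_neighborhood G v" for v
    using A(3) by (auto simp: closed_neighborhood_def)
  have "w i \<in> closed_neighborhood ?T (vs ! i)" if "i < length vs" for i
    using A(2) that by (auto simp: footprint_arcs_def closed_neighborhood_def)
  \<comment> \<open>Earlier vertices dominate no more in \<open>?T\<close> than in \<open>G\<close>,
    so \<open>w i\<close> is still new when \<open>vs ! i\<close> is reached.\<close>
  then have "w i \<in> closed_neighborhood ?T (vs ! i) - (\<Union>j<i. closed_neighborhood ?T (vs ! j))"
    if "i < length vs" for i
    using w[OF that] sub that by blast
  then have "legal_sequence ?T vs"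
    using vs unfolding legal_sequence_def by fastforce
  then have "length vs \<le> grundy_domination_number ?T"
    unfolding grundy_domination_number_def
    by (intro Max_ge finite_legal_sequence_lengths) (use pair_finite_verts in auto)
  then show ?thesis
    using forest_arcs_spanning_tree[OF assms A(1,3,4)] len by metis
qed

end
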